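(* Let $n,k$ be positive integers. (i) If $n$ is not divisible by $k$, say $n=mk+j$ with $1\le j\le k-1$, then $$\mathrm{SgnMPE}_n^k(t)=\mathrm{SgnMPE}_{n,1}^k(t)=(1-t)^{n-k}.$$ (ii) If $n$ is divisible by $k$, say $n=mk$, then $$\mathrm{SgnMPE}_{n,r}^k(t)=\begin{cases}(1-t)^{n-k} & \text{if } r=1,\\ (-1)^{(mr-1)(k-r+1)}\,t^{k-r+1}(1-t)^{n-k} & \text{if } 2\le r\le k.\end{cases}$$
   Context: $\mathfrak{S}_n$ is the symmetric group on $[n]=\{1,\dots,n\}$, with $\pi=\pi_1\pi_2\cdots\pi_n$ in one-line notation. $\mathrm{exc}(\pi)=|\{i\in[n-1]:\pi_i>i\}|$ and $\mathrm{inv}(\pi)=|\{(i,j): i<j,\ \pi_i>\pi_j\}|$. For a positive integer $k$ and $1\le r\le k$, $\mathrm{MP}_{n,r}^k$ is the set of $\pi\in\mathfrak{S}_n$ with $\pi_i-i\equiv r-1\pmod k$ for all $1\le i\le n$. The set of mod-$k$-alternating permutations is $\mathrm{MP}_n^k=\{\pi\in\mathfrak{S}_n:\pi_i\equiv i\pmod k \text{ for all } i\}=\mathrm{MP}_{n,1}^k$. $\mathrm{SgnMPE}_{n,r}^k(t)=\sum_{\pi\in\mathrm{MP}_{n,r}^k}(-1)^{\mathrm{inv}(\pi)}t^{\mathrm{exc}(\pi)}$, and $\mathrm{SgnMPE}_n^k(t)$ denotes the same sum taken over $\mathrm{MP}_n^k$.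
   Formalization: In part (i) with n < k (m = 0) the formula (1-t)^{n-k} has a negative exponent and is false, since the sum is 1 (e.g. n = 1, k = 2); there the exponent is taken to be 0, so that the sum is claimed to be 1. *)

theory Defs
  imports "HOL-Combinatorics.Permutations" "HOL-Computational_Algebra.Polynomial" "HOL-Number_Theory.Cong"
begin

text \<open>The symmetric group on \<open>{1..n}\<close> is \<open>{p. p permutes {1..n}}\<close>, with \<open>p i\<close> the \<open>i\<close>-th letter of
  the one-line notation.\<close>

definition exc :: "nat \<Rightarrow> (nat \<Rightarrow> nat) \<Rightarrow> nat" where
  "exc n p = card {i \<in> {1..n-1}. p i > i}"

definition inversions :: "nat \<Rightarrow> (nat \<Rightarrow> nat) \<Rightarrow> nat" where
  "inversions n p = card {(i, j). i \<in> {1..n} \<and> j \<in> {1..n} \<and> i < j \<and> p i > p j}"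

text \<open>The congruence is over the integers, since \<open>p i - i\<close> may be negative.\<close>

definition MPr :: "nat \<Rightarrow> nat \<Rightarrow> nat \<Rightarrow> (nat \<Rightarrow> nat) set" where
  "MPr k n r = {p. p permutes {1..n} \<and>
     (\<forall>i\<in>{1..n}. [int (p i) - int i = int r - 1] (mod int k))}"

definition MP :: "nat \<Rightarrow> nat \<Rightarrow> (nat \<Rightarrow> nat) set" where
  "MP k n = {p. p permutes {1..n} \<and> (\<forall>i\<in>{1..n}. [p i = i] (mod k))}"

abbreviation tvar :: "int poly" where
  "tvar \<equiv> [:0, 1:]"

definition SgnMPEr :: "nat \<Rightarrow> nat \<Rightarrow> nat \<Rightarrow> int poly" where
  "SgnMPEr k n r = (\<Sum>p\<in>MPr k n r. (-1) ^ inversions n p * tvar ^ exc n p)"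

definition SgnMPE :: "nat \<Rightarrow> nat \<Rightarrow> int poly" where
  "SgnMPE k n = (\<Sum>p\<in>MP k n. (-1) ^ inversions n p * tvar ^ exc n p)"

text \<open>Exponents \<open>n - k\<close> of \<open>1 - tvar\<close> are natural numbers with truncated subtraction. This
  matters only for \<open>n < k\<close>, where \<open>MP k n\<close> contains just the identity and its polynomial is
  \<open>1 = (1 - tvar) ^ 0\<close>.\<close>

end

theory Submission
  imports Defs "Jordan_Normal_Form.Determinant"
begin

text \<open>
  Put \<open>s = 0\<close> if \<open>r = 1\<close> and \<open>s = k - r + 1\<close> if \<open>r \<ge> 2\<close>, so that the permutations in question are
  those with \<open>p i \<equiv> i - s\<close> modulo \<open>k\<close> for all \<open>i\<close>. Since \<open>(-1) ^ inversions n p\<close> is the sign of \<open>p\<close>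
  (lemma \<open>sign_eq_minus_one_power_inversions\<close>), the polynomial is the determinant of the matrix
  whose entry at \<open>(i, j)\<close> is \<open>0\<close> unless \<open>j \<equiv> i - s\<close>, and otherwise is \<open>t\<close> above the diagonal and \<open>1\<close>
  on and below it.

  Rows \<open>i\<close> and \<open>i - k\<close> of this matrix have the same support, and they differ only in the columns
  \<open>j\<close> with \<open>i - k < j \<le> i\<close>, just one of which, \<open>j = i - s\<close>, lies in the support. Subtracting from
  each row \<open>i > k\<close> the row \<open>i - k\<close> therefore leaves the determinant unchanged
  (\<open>signed_sum_subtract_row_above\<close>) and turns row \<open>i\<close> into the single entry \<open>1 - t\<close> in column
  \<open>i - s\<close> (\<open>weight_subtract_row_above\<close>).

  These \<open>n - k\<close> rows now force \<open>p i = i - s\<close> for \<open>i > k\<close>. When \<open>s = 0\<close> or \<open>k\<close> divides \<open>n\<close>, the columns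
  that remain for the first \<open>k\<close> rows leave a single choice as well, namely the cyclic rotation
  \<open>i \<mapsto> i - s\<close> modulo \<open>n\<close> (\<open>eq_rotation_if_reduced_weight_nonzero\<close>). Its first \<open>s\<close> rows contribute a
  factor \<open>t\<close> each, the other rows up to \<open>k\<close> a factor \<open>1\<close>, each row beyond \<open>k\<close> a factor \<open>1 - t\<close>, and its sign is \<open>(-1) ^ (s * (n - s))\<close>. Both
  parts of the theorem are this one formula, up to the parity of the exponent of \<open>-1\<close>.
\<close>

section \<open>Inversions and the sign of a permutation\<close>

definition pairs :: "nat \<Rightarrow> (nat \<times> nat) set" where
  "pairs n = {(i, j). i \<in> {1..n} \<and> j \<in> {1..n} \<and> i < j}"

lemma finite_pairs: "finite (pairs n)"
  by (rule finite_subset[of _ "{1..n} \<times> {1..n}"]) (auto simp: pairs_def)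

lemma inversions_eq_card_pairs: "inversions n p = card {(i, j) \<in> pairs n. p i > p j}"
  unfolding inversions_def pairs_def by (rule arg_cong[where f = card]) auto

lemma minus_one_power_inversions:
  "(-1) ^ inversions n p = (\<Prod>(i, j)\<in>pairs n. if p i > p j then -1 else (1 :: int))"
proof -
  have "(\<Prod>x\<in>pairs n. if p (fst x) > p (snd x) then -1 else (1 :: int))
      = (-1) ^ card {x \<in> pairs n. p (fst x) > p (snd x)}"
    using prod.inter_filter[OF finite_pairs, where g = "\<lambda>_. -1 :: int"
        and P = "\<lambda>x. p (fst x) > p (snd x)", of n, symmetric] by simp
  then show ?thesis
    by (simp add: inversions_eq_card_pairs case_prod_unfold)
qed

text \<open>
  A permutation acts on two-element subsets; the increasing pair is the chosen representative of such
  a subset.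
\<close>

lemma bij_betw_sorted_image_pairs:
  assumes "q permutes {1..n}"
  shows "bij_betw (\<lambda>(i, j). (min (q i) (q j), max (q i) (q j))) (pairs n) (pairs n)"
proof -
  let ?g = "\<lambda>(i, j). (min (q i) (q j), max (q i) (q j))"
  have inj: "q x = q y \<longleftrightarrow> x = y" for x y
    using permutes_inj[OF assms] by (auto dest: injD)
  have img: "q x \<in> {1..n} \<longleftrightarrow> x \<in> {1..n}" for x
    using permutes_in_image[OF assms] by blast
  have "inj_on ?g (pairs n)"
  proof (rule inj_onI, clarify)
    fix i j i' j'
    assume ij: "(i, j) \<in> pairs n" and ij': "(i', j') \<in> pairs n"
      and mm: "min (q i) (q j) = min (q i') (q j')" "max (q i) (q j) = max (q i') (q j')"
    have "q i = q i' \<and> q j = q j' \<or> q i = q j' \<and> q j = q i'"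
      using mm by (auto simp: min_def max_def split: if_splits)
    then show "i = i' \<and> j = j'"
      using ij ij' by (auto simp: inj pairs_def)
  qed
  moreover have "?g ` pairs n \<subseteq> pairs n"
  proof clarify
    fix i j assume "(i, j) \<in> pairs n"
    then show "(min (q i) (q j), max (q i) (q j)) \<in> pairs n"
      using img[of i] img[of j] inj[of i j] by (auto simp: pairs_def min_def max_def)
  qed
  ultimately show ?thesis
    using endo_inj_surj[OF finite_pairs] by (simp only: bij_betw_def)
qed

text \<open>
  Reindexing the Vandermonde-type product by the action of \<open>q\<close> on unordered pairs flips the sign of
  one factor for every inversion of \<open>q\<close>.
\<close>

lemma prod_differences_permuted:
  fixes f :: "nat \<Rightarrow> int"
  assumes "q permutes {1..n}"
  shows "(\<Prod>(i, j)\<in>pairs n. f (q j) - f (q i))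
       = (-1) ^ inversions n q * (\<Prod>(i, j)\<in>pairs n. f j - f i)"
proof -
  let ?g = "\<lambda>(i, j). (min (q i) (q j), max (q i) (q j))"
  let ?h = "\<lambda>(i, j). f j - f i"
  have "(\<Prod>(i, j)\<in>pairs n. f (q j) - f (q i))
      = (\<Prod>x\<in>pairs n. (case x of (i, j) \<Rightarrow> if q i > q j then -1 else 1) * ?h (?g x))"
    by (rule prod.cong) (auto simp: min_def max_def)
  also have "\<dots> = (-1) ^ inversions n q * (\<Prod>x\<in>pairs n. ?h (?g x))"
    by (simp add: prod.distrib minus_one_power_inversions)
  also have "(\<Prod>x\<in>pairs n. ?h (?g x)) = (\<Prod>x\<in>pairs n. ?h x)"
    by (rule prod.reindex_bij_betw[OF bij_betw_sorted_image_pairs[OF assms]])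
  finally show ?thesis .
qed

text \<open>
  The product of the differences \<open>p (q j) - p (q i)\<close> is computed in two ways from the product \<open>D\<close> of
  the differences \<open>j - i\<close>: reindexing along \<open>p \<circ> q\<close> at once, or along \<open>q\<close> and then along \<open>p\<close>. The
  nonzero factor \<open>D\<close> cancels.
\<close>

lemma minus_one_power_inversions_compose:
  assumes p: "p permutes {1..n}" and q: "q permutes {1..n}"
  shows "(-1 :: int) ^ inversions n (p \<circ> q) = (-1) ^ inversions n p * (-1) ^ inversions n q"
proof -
  define D where "D = (\<Prod>(i, j)\<in>pairs n. int j - int i)"
  have "D \<noteq> 0"
    unfolding D_def by (subst prod_zero_iff[OF finite_pairs]) (auto simp: pairs_def)
  have "(-1) ^ inversions n (p \<circ> q) * D = (\<Prod>(i, j)\<in>pairs n. int (p (q j)) - int (p (q i)))"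
    using prod_differences_permuted[OF permutes_compose[OF q p], of int] by (simp add: D_def)
  also have "\<dots> = (-1) ^ inversions n q * ((-1) ^ inversions n p * D)"
    using prod_differences_permuted[OF q, of "\<lambda>i. int (p i)"]
      prod_differences_permuted[OF p, of int] by (simp add: D_def)
  finally show ?thesis using \<open>D \<noteq> 0\<close> by simp
qed

text \<open>
  Besides \<open>(a, b)\<close> itself, each point strictly between \<open>a\<close> and \<open>b\<close> forms one inversion with \<open>a\<close> and
  one with \<open>b\<close>.
\<close>

lemma odd_inversions_transpose:
  assumes "a \<in> {1..n}" "b \<in> {1..n}" "a < b"
  shows "odd (inversions n (transpose a b))"
proof -
  have "{(i, j). i \<in> {1..n} \<and> j \<in> {1..n} \<and> i < j \<and> transpose a b i > transpose a b j}
      = insert (a, b) ({a} \<times> {a<..<b} \<union> {a<..<b} \<times> {b})"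
    using assms by (auto simp: transpose_def split: if_splits)
  moreover have "card ({a} \<times> {a<..<b} \<union> {a<..<b} \<times> {b}) = 2 * card {a<..<b}"
    by (subst card_Un_disjoint) auto
  ultimately show ?thesis
    by (simp add: inversions_def)
qed

text \<open>
  Both sides are multiplicative and take the value \<open>-1\<close> at transpositions, which generate the
  symmetric group.
\<close>

lemma sign_eq_minus_one_power_inversions:
  assumes "p permutes {1..n}"
  shows "sign p = (-1) ^ inversions n p"
  using assms finite_atLeastAtMost
proof (induction rule: permutes_induct)
  case id
  have "{(i, j). i \<in> {1..n} \<and> j \<in> {1..n} \<and> i < j \<and> id i > id j} = {}"
    by auto
  then have "inversions n id = 0"
    by (simp only: inversions_def card.empty)
  then show ?case by (simp only: sign_id power_0)
next
  case (swap a b p)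
  have "odd (inversions n (transpose a b))"
    using swap.hyps odd_inversions_transpose[of a n b] odd_inversions_transpose[of b n a]
    by (metis nat_neq_iff transpose_commute)
  then have "(-1 :: int) ^ inversions n (transpose a b) = -1"
    by (rule neg_one_odd_power)
  moreover have "sign (transpose a b \<circ> p) = - sign p"
    using sign_compose[OF permutation_swap_id permutation_permutes[THEN iffD2], of p a b]
      swap.hyps by (auto simp: sign_swap_id)
  ultimately show ?case
    using minus_one_power_inversions_compose[OF permutes_swap_id[OF swap.hyps(1,2)] swap.hyps(4)]
      swap.IH by (simp only: mult_minus_left mult_1_left)
qed

section \<open>Determinants as signed sums over permutations\<close>

definition signed_sum :: "nat \<Rightarrow> (nat \<Rightarrow> nat \<Rightarrow> 'a :: comm_ring_1) \<Rightarrow> 'a" where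
  "signed_sum n a = (\<Sum>p | p permutes {1..n}. (-1) ^ inversions n p * (\<Prod>i\<in>{1..n}. a i (p i)))"

text \<open>
  Matrix indices start at \<open>0\<close> whereas the permutations act on \<open>{1..n}\<close>. Index \<open>0\<close> is filled with
  a unit row and column instead of shifting all indices by one: the permutations of \<open>{0..n}\<close> that
  fix \<open>0\<close> are literally the permutations of \<open>{1..n}\<close>.
\<close>

definition bordered_mat :: "nat \<Rightarrow> (nat \<Rightarrow> nat \<Rightarrow> 'a :: comm_ring_1) \<Rightarrow> 'a mat" where
  "bordered_mat n a = mat (Suc n) (Suc n)
     (\<lambda>(i, j). if i = 0 \<or> j = 0 then (if i = j then 1 else 0) else a i j)"

text \<open>
  In the Leibniz expansion, row \<open>0\<close> kills every permutation that moves \<open>0\<close>.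
\<close>

lemma signed_sum_eq_det: "signed_sum n a = det (bordered_mat n a)"
proof -
  let ?A = "bordered_mat n a"
  have indices: "{0..<Suc n} = insert 0 {1..n}" by auto
  have "det ?A = (\<Sum>p | p permutes {0..<Suc n}. signof p * (\<Prod>i\<in>{0..<Suc n}. ?A $$ (i, p i)))"
    by (rule det_def') (simp add: bordered_mat_def)
  also have "\<dots> = (\<Sum>p | p permutes {1..n}. signof p * (\<Prod>i\<in>{0..<Suc n}. ?A $$ (i, p i)))"
  proof (rule sum.mono_neutral_right, goal_cases)
    case 1
    then show ?case by (simp add: finite_permutations)
  next
    case 2
    then show ?case by (auto intro: permutes_subset)
  next
    case 3
    show ?case
    proof
      fix p assume "p \<in> {p. p permutes {0..<Suc n}} - {p. p permutes {1..n}}"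
      then have p: "p permutes {0..<Suc n}" and np: "\<not> p permutes {1..n}"
        by blast+
      have "p 0 \<noteq> 0"
      proof
        assume "p 0 = 0"
        then have "p x = x" if "x \<in> {0..<Suc n} - {1..n}" for x
          using that by (cases "x = 0") auto
        then show False
          using np permutes_superset[OF p] by blast
      qed
      moreover have "p 0 < Suc n"
        using permutes_in_image[OF p, of 0] by simp
      ultimately have "?A $$ (0, p 0) = 0"
        by (simp add: bordered_mat_def)
      then have "(\<Prod>i\<in>{0..<Suc n}. ?A $$ (i, p i)) = 0"
        by (intro prod_zero) auto
      then show "signof p * (\<Prod>i\<in>{0..<Suc n}. ?A $$ (i, p i)) = 0" by simp
    qed
  qed
  also have "\<dots> = signed_sum n a"
    unfolding signed_sum_def
  proof (rule sum.cong, goal_cases)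
    case (2 p)
    then have p: "p permutes {1..n}" by simp
    then have "p 0 = 0" by (simp add: permutes_not_in)
    moreover have "?A $$ (i, p i) = a i (p i)" if "i \<in> {1..n}" for i
      using permutes_in_image[OF p, of i] that by (auto simp: bordered_mat_def)
    ultimately have "(\<Prod>i\<in>{0..<Suc n}. ?A $$ (i, p i)) = (\<Prod>i\<in>{1..n}. a i (p i))"
      unfolding indices by (simp add: bordered_mat_def)
    then show ?case
      by (simp add: sign_eq_minus_one_power_inversions[OF p])
  qed simp
  finally show ?thesis by simp
qed

text \<open>
  All the subtractions are made at once, from the original rows, which amounts to multiplication from
  the left by a lower unitriangular matrix.
\<close>

lemma signed_sum_subtract_row_above:
  assumes "k \<ge> 1"
  shows "signed_sum n (\<lambda>i j. a i j - (if i > k then a (i - k) j else 0)) = signed_sum n a"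
proof -
  let ?b = "\<lambda>i j. a i j - (if i > k then a (i - k) j else 0)"
  define L :: "'a mat" where "L = mat (Suc n) (Suc n)
    (\<lambda>(i, j). (if j = i then 1 else 0) - (if i > k \<and> j = i - k then 1 else 0))"
  have L: "L \<in> carrier_mat (Suc n) (Suc n)" and A: "bordered_mat n a \<in> carrier_mat (Suc n) (Suc n)"
    by (simp_all add: L_def bordered_mat_def)
  \<comment> \<open>The strict inequality \<open>i > k\<close> keeps the border row \<open>0\<close> out of the subtractions.\<close>
  have "bordered_mat n ?b = L * bordered_mat n a"
  proof (rule eq_matI)
    fix i j assume "i < dim_row (L * bordered_mat n a)" "j < dim_col (L * bordered_mat n a)"
    then have i: "i < Suc n" and j: "j < Suc n" by (simp_all add: L_def bordered_mat_def)
    have "(L * bordered_mat n a) $$ (i, j)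
        = (\<Sum>l\<in>{0..<Suc n}. L $$ (i, l) * bordered_mat n a $$ (l, j))"
      using i j L A by (simp add: scalar_prod_def del: sum.op_ivl_Suc)
    also have "\<dots> = (\<Sum>l\<in>{0..<Suc n}. (if l = i then bordered_mat n a $$ (i, j) else 0)
        - (if l = i - k then if i > k then bordered_mat n a $$ (i - k, j) else 0 else 0))"
      using i j by (intro sum.cong) (auto simp: L_def)
    also have "\<dots> = bordered_mat n a $$ (i, j)
        - (if i > k then bordered_mat n a $$ (i - k, j) else 0)"
      using i less_imp_diff_less[OF i, of k] by (simp add: sum_subtractf del: sum.op_ivl_Suc)
    also have "\<dots> = bordered_mat n ?b $$ (i, j)"
      using i j assms by (auto simp: bordered_mat_def)
    finally show "bordered_mat n ?b $$ (i, j) = (L * bordered_mat n a) $$ (i, j)" by simp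
  qed (simp_all add: L_def bordered_mat_def)
  moreover have "det L = 1"
  proof -
    have "det L = (\<Prod>i\<in>{0..<Suc n}. L $$ (i, i))"
      using L by (subst det_lower_triangular[OF _ L]) (auto simp: L_def prod_list_diag_prod)
    also have "\<dots> = 1"
      using assms by (intro prod.neutral) (auto simp: L_def)
    finally show ?thesis .
  qed
  ultimately show ?thesis
    using L A by (simp add: signed_sum_eq_det det_mult)
qed

section \<open>The weighted sum over permutations with a fixed residue of displacement\<close>

text \<open>
  The congruence \<open>j \<equiv> i - s\<close> modulo \<open>k\<close> is written without subtraction.
\<close>

definition weight :: "nat \<Rightarrow> nat \<Rightarrow> 'a \<Rightarrow> nat \<Rightarrow> nat \<Rightarrow> 'a :: comm_ring_1" where
  "weight k s t i j = (if [j + s = i] (mod k) then if i < j then t else 1 else 0)"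

text \<open>
  The map \<open>i \<mapsto> i - s\<close> modulo \<open>n\<close> with representatives in \<open>{1..n}\<close>, extended by the identity as
  \<open>permutes\<close> requires.
\<close>

definition rotation :: "nat \<Rightarrow> nat \<Rightarrow> nat \<Rightarrow> nat" where
  "rotation n s i = (if i \<in> {1..n} then if i \<le> s then n + i - s else i - s else i)"

lemma rotation_permutes:
  assumes "s \<le> n"
  shows "rotation n s permutes {1..n}"
proof (rule bij_imp_permutes)
  have "inj_on (rotation n s) {1..n}"
    using assms by (auto simp: inj_on_def rotation_def split: if_splits)
  moreover have "rotation n s ` {1..n} \<subseteq> {1..n}"
    using assms by (auto simp: rotation_def split: if_splits)
  ultimately show "bij_betw (rotation n s) {1..n} {1..n}"
    by (simp add: bij_betw_def endo_inj_surj)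
qed (auto simp: rotation_def)

text \<open>
  The rotation is increasing on each of \<open>{1..s}\<close> and \<open>{s<..n}\<close> and exchanges the order of these two
  blocks.
\<close>

lemma inversions_rotation:
  assumes "s \<le> n"
  shows "inversions n (rotation n s) = s * (n - s)"
proof -
  have "{(i, j). i \<in> {1..n} \<and> j \<in> {1..n} \<and> i < j \<and> rotation n s i > rotation n s j}
      = {1..s} \<times> {s<..n}"
    using assms by (auto simp: rotation_def split: if_splits)
  then show ?thesis by (simp add: inversions_def)
qed

lemma prod_weight:
  assumes "p permutes {1..n}"
  shows "(\<Prod>i\<in>{1..n}. weight k s t i (p i))
       = (if \<forall>i\<in>{1..n}. [p i + s = i] (mod k) then t ^ exc n p else 0)"
proof (cases "\<forall>i\<in>{1..n}. [p i + s = i] (mod k)")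
  case True
  \<comment> \<open>The last position is never an excedance, so it may be included.\<close>
  have "{i \<in> {1..n-1}. p i > i} = {i \<in> {1..n}. p i > i}"
  proof safe
    fix i assume "i \<in> {1..n}" "p i > i"
    moreover have "p i \<le> n" using permutes_in_image[OF assms, of i] \<open>i \<in> {1..n}\<close> by simp
    ultimately show "i \<in> {1..n-1}" by auto
  qed auto
  then have exc: "exc n p = card {i \<in> {1..n}. i < p i}"
    by (simp add: exc_def)
  have "(\<Prod>i\<in>{1..n}. weight k s t i (p i)) = (\<Prod>i\<in>{1..n}. if i < p i then t else 1)"
    using True by (intro prod.cong) (auto simp: weight_def)
  also have "\<dots> = t ^ exc n p"
    unfolding exc using prod.inter_filter[of "{1..n}" "\<lambda>_. t" "\<lambda>i. i < p i", symmetric] by simp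
  finally show ?thesis using True by simp
next
  case False
  then obtain i where "i \<in> {1..n}" "\<not> [p i + s = i] (mod k)" by blast
  then have "(\<Prod>i\<in>{1..n}. weight k s t i (p i)) = 0"
    by (intro prod_zero) (auto simp: weight_def)
  then show ?thesis using False by auto
qed

definition reduced_weight :: "nat \<Rightarrow> nat \<Rightarrow> 'a \<Rightarrow> nat \<Rightarrow> nat \<Rightarrow> 'a :: comm_ring_1" where
  "reduced_weight k s t i j =
     (if i \<le> k then weight k s t i j else if j + s = i then 1 - t else 0)"

text \<open>
  For \<open>i > k\<close> the two rows have the same support, on which they cancel where \<open>j \<le> i - k\<close> (both entries \<open>1\<close>) and where \<open>j > i\<close> (both \<open>t\<close>).
  In the window \<open>i - k < j \<le> i\<close> the difference is \<open>1 - t\<close> on the support, and there the number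
  \<open>j + s - i\<close> is a multiple of \<open>k\<close> of absolute value less than \<open>k\<close>.
\<close>

lemma weight_subtract_row_above:
  assumes "s < k"
  shows "weight k s t i j - (if i > k then weight k s t (i - k) j else 0) = reduced_weight k s t i j"
proof (cases "i > k")
  case True
  have same: "[j + s = i - k] (mod k) \<longleftrightarrow> [j + s = i] (mod k)"
    using True unfolding cong_def by (metis less_imp_le le_mod_geq)
  have exact: "j + s = i" if c: "[j + s = i] (mod k)" and "i - k < j" "j \<le> i"
  proof -
    have "int k dvd int (j + s) - int i"
      using c cong_iff_dvd_diff cong_int_iff by blast
    moreover have "\<bar>int (j + s) - int i\<bar> < int k"
      using that assms True by linarith
    ultimately show ?thesis
      using dvd_imp_le_int[of "int (j + s) - int i" "int k"] by fastforce
  qed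
  have conv: "[j + s = i] (mod k)" "i - k < j" "j \<le> i" if "j + s = i"
    using that assms True by auto
  show ?thesis
    unfolding reduced_weight_def weight_def same
    using True exact conv by auto
next
  case False
  then show ?thesis by (simp add: reduced_weight_def)
qed

text \<open>
  The rows \<open>i > k\<close> occupy the columns \<open>j\<close> with \<open>k < j + s \<le> n\<close>. A row \<open>i \<le> k\<close> thus has
  \<open>p i + s \<le> k\<close>, where the congruence leaves only \<open>p i + s = i\<close>, or \<open>p i + s > n\<close>. The latter is
  impossible for \<open>s = 0\<close>, and if \<open>k\<close> divides \<open>n\<close> the congruence leaves only \<open>p i + s = n + i\<close>.
\<close>

lemma eq_rotation_if_reduced_weight_nonzero:
  fixes t :: "'a :: comm_ring_1"
  assumes p: "p permutes {1..n}" and s: "s < k" and sn: "s = 0 \<or> k dvd n"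
    and nz: "\<forall>i\<in>{1..n}. reduced_weight k s t i (p i) \<noteq> 0"
  shows "p = rotation n s"
proof
  fix i
  have low: "p i + s = i" if "i \<in> {1..n}" "i > k" for i
    using nz that by (auto simp: reduced_weight_def split: if_splits)
  show "p i = rotation n s i"
  proof (cases "i \<in> {1..n}")
    case i: True
    then have pi: "p i \<in> {1..n}" using permutes_in_image[OF p] by blast
    show ?thesis
    proof (cases "i > k")
      case True
      then show ?thesis using low[OF i True] i s by (auto simp: rotation_def)
    next
      case False
      then have c: "[p i + s = i] (mod k)"
        using nz i by (auto simp: reduced_weight_def weight_def split: if_splits)
      \<comment> \<open>Otherwise \<open>p\<close> would take the value \<open>p i\<close> also at row \<open>p i + s > k\<close>.\<close>
      have outside: "p i + s \<le> k \<or> p i + s > n"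
      proof (rule ccontr)
        assume "\<not> ?thesis"
        then have u: "p i + s \<in> {1..n}" "p i + s > k" by auto
        from low[OF u] have "p (p i + s) = p i" by simp
        then have "p i + s = i"
          using permutes_inj[OF p] by (auto dest: injD)
        then show False using u False by simp
      qed
      have dv: "int k dvd int (p i + s) - int i"
        using c cong_iff_dvd_diff cong_int_iff by blast
      show ?thesis
      proof (cases "p i + s \<le> k")
        case True
        have "\<bar>int (p i + s) - int i\<bar> < int k"
          using True False i pi by auto
        then have "p i + s = i"
          using dv dvd_imp_le_int[of "int (p i + s) - int i" "int k"] by fastforce
        then show ?thesis using i pi by (auto simp: rotation_def)
      next
        case far: False
        then have gt: "p i + s > n" using outside by simp
        then have "s \<noteq> 0" using pi by auto
        then have "k dvd n" using sn by simp
        then have "int k dvd int (p i + s) - int i - int n"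
          using dv by (simp add: dvd_diff)
        moreover have "\<bar>int (p i + s) - int i - int n\<bar> < int k"
          using gt False i pi s by auto
        ultimately have "p i + s = n + i"
          using dvd_imp_le_int[of "int (p i + s) - int i - int n" "int k"] by fastforce
        then show ?thesis using i pi by (auto simp: rotation_def)
      qed
    qed
  next
    case False
    then show ?thesis using permutes_not_in[OF p False] by (simp only: rotation_def if_False)
  qed
qed

text \<open>
  If \<open>n < k\<close> then \<open>s = 0\<close>, there are no reduced rows, and the truncated exponent \<open>n - k = 0\<close> is the
  right one.
\<close>

lemma prod_reduced_weight_rotation:
  assumes n: "n \<ge> 1" and s: "s < k" and sn: "s = 0 \<or> k dvd n"
  shows "(\<Prod>i\<in>{1..n}. reduced_weight k s t i (rotation n s i)) = t ^ s * (1 - t) ^ (n - k)"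
proof -
  have sle: "s \<le> n" using sn n s dvd_imp_le[of k n] by auto
  have entry: "reduced_weight k s t i (rotation n s i)
      = (if i \<in> {..s} then t else 1) * (if i \<in> {k<..} then 1 - t else 1)" if i: "i \<in> {1..n}" for i
  proof (cases "i \<le> s")
    case True
    then have "k dvd n" using sn i by auto
    then have "[n + i = i] (mod k)" by (simp add: cong_def mod_add_left_eq[symmetric])
    moreover have "s < n" using \<open>k dvd n\<close> n s dvd_imp_le[of k n] by auto
    ultimately show ?thesis
      using True i s sle by (auto simp: reduced_weight_def weight_def rotation_def)
  next
    case False
    then show ?thesis
      using i s by (auto simp: reduced_weight_def weight_def rotation_def)
  qed
  have "(\<Prod>i\<in>{1..n}. reduced_weight k s t i (rotation n s i))
      = (\<Prod>i\<in>{1..n}. if i \<in> {..s} then t else 1) * (\<Prod>i\<in>{1..n}. if i \<in> {k<..} then 1 - t else 1)"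
    using entry by (simp add: prod.distrib)
  also have "\<dots> = t ^ card ({1..n} \<inter> {..s}) * (1 - t) ^ card ({1..n} \<inter> {k<..})"
    by (simp only: prod.inter_restrict[OF finite_atLeastAtMost, symmetric] prod_constant)
  also have "{1..n} \<inter> {..s} = {1..s}" using sle by auto
  also have "{1..n} \<inter> {k<..} = {k<..n}" by auto
  finally show ?thesis by simp
qed

text \<open>
  Only the rotation survives in the Leibniz expansion of the row-reduced matrix.
\<close>

theorem sum_congruent_permutations:
  fixes t :: "'a :: comm_ring_1"
  assumes n: "n \<ge> 1" and s: "s < k" and sn: "s = 0 \<or> k dvd n"
  shows "(\<Sum>p | p permutes {1..n} \<and> (\<forall>i\<in>{1..n}. [p i + s = i] (mod k)).
            (-1) ^ inversions n p * t ^ exc n p)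
       = (-1) ^ (s * (n - s)) * t ^ s * (1 - t) ^ (n - k)"
proof -
  have sle: "s \<le> n" using sn n s dvd_imp_le[of k n] by auto
  have "(\<Sum>p | p permutes {1..n} \<and> (\<forall>i\<in>{1..n}. [p i + s = i] (mod k)).
            (-1) ^ inversions n p * t ^ exc n p) = signed_sum n (weight k s t)"
    unfolding signed_sum_def
  proof (rule sum.mono_neutral_cong_left, goal_cases)
    case 1
    then show ?case by (simp add: finite_permutations)
  next
    case 3
    show ?case
      using prod_weight[of _ n k s t] by (auto simp del: prod_zero_iff)
  next
    case (4 p)
    then show ?case using prod_weight[of p n k s t] by simp
  qed auto
  also have "\<dots> = signed_sum n (reduced_weight k s t)"
    using s signed_sum_subtract_row_above[of k n "weight k s t"]
    by (simp add: weight_subtract_row_above)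
  also have "\<dots> = (\<Sum>p\<in>{rotation n s}.
      (-1) ^ inversions n p * (\<Prod>i\<in>{1..n}. reduced_weight k s t i (p i)))"
    unfolding signed_sum_def
  proof (rule sum.mono_neutral_right, goal_cases)
    case 3
    show ?case
    proof
      fix p assume "p \<in> {p. p permutes {1..n}} - {rotation n s}"
      then have p: "p permutes {1..n}" and "p \<noteq> rotation n s"
        by blast+
      then have "\<exists>i\<in>{1..n}. reduced_weight k s t i (p i) = 0"
        using eq_rotation_if_reduced_weight_nonzero[OF p s sn, of t] by auto
      then have "(\<Prod>i\<in>{1..n}. reduced_weight k s t i (p i)) = 0"
        by (intro prod_zero) auto
      then show "(-1) ^ inversions n p * (\<Prod>i\<in>{1..n}. reduced_weight k s t i (p i)) = 0"
        by simp
    qed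
  qed (use rotation_permutes[OF sle] in \<open>simp_all add: finite_permutations\<close>)
  also have "\<dots> = (-1) ^ (s * (n - s)) * t ^ s * (1 - t) ^ (n - k)"
    using prod_reduced_weight_rotation[OF n s sn, of t] sle
    by (simp add: inversions_rotation mult.assoc)
  finally show ?thesis .
qed

section \<open>The signed Eulerian polynomials\<close>

text \<open>
  The two alternatives cover \<open>r = 1\<close> with shift \<open>s = 0\<close> and \<open>2 \<le> r \<le> k\<close> with \<open>s = k - r + 1\<close>: in
  both, \<open>r - 1\<close> and \<open>-s\<close> agree modulo \<open>k\<close>.
\<close>

lemma cong_displacement_iff:
  assumes "s + r = Suc 0 \<or> s + r = Suc k"
  shows "[int x - int i = int r - 1] (mod int k) \<longleftrightarrow> [x + s = i] (mod k)"
proof -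
  have "[int x - int i = int r - 1] (mod int k) \<longleftrightarrow> int k dvd (int x - int i) - (int r - 1)"
    by (rule cong_iff_dvd_diff)
  also have "\<dots> \<longleftrightarrow> int k dvd int (x + s) - int i"
  proof -
    consider "(int x - int i) - (int r - 1) = int (x + s) - int i"
      | "(int x - int i) - (int r - 1) = (int (x + s) - int i) - int k"
      using assms by linarith
    then show ?thesis
      by cases (simp_all only: dvd_diff_left_iff dvd_refl)
  qed
  also have "\<dots> \<longleftrightarrow> [x + s = i] (mod k)"
    by (simp only: cong_iff_dvd_diff[symmetric] cong_int_iff)
  finally show ?thesis .
qed

lemma SgnMPEr_eq:
  assumes "n \<ge> 1" "s < k" "s = 0 \<or> k dvd n" and r: "s + r = Suc 0 \<or> s + r = Suc k"
  shows "SgnMPEr k n r = (-1) ^ (s * (n - s)) * tvar ^ s * (1 - tvar) ^ (n - k)"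
  unfolding SgnMPEr_def MPr_def cong_displacement_iff[OF r]
  by (rule sum_congruent_permutations[OF assms(1-3)])

lemma MP_eq_MPr: "MP k n = MPr k n 1"
  unfolding MP_def MPr_def using cong_displacement_iff[of 0 1] by simp

text \<open>
  With \<open>s = k - r + 1\<close> the two exponents differ by \<open>s * (s - 1) * (m - 1)\<close>, which is even.
\<close>

lemma even_rotation_exponent_iff:
  fixes m r k :: nat
  assumes "m \<ge> 1" "2 \<le> r" "r \<le> k"
  shows "even ((k - r + 1) * (m * k - (k - r + 1))) \<longleftrightarrow> even ((m * r - 1) * (k - r + 1))"
proof -
  define s where "s = k - r + 1"
  have k: "k = s + r - 1" and "k \<ge> 1" using assms by (auto simp: s_def)
  have "s \<le> m * k" using assms by (cases m) (auto simp: s_def)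
  moreover have "m * r \<ge> 1" using assms by simp
  ultimately have "even (m * k - s) \<longleftrightarrow> even (m * k + s)" "even (m * r - 1) \<longleftrightarrow> even (m * r + 1)"
    by (simp_all only: even_diff_nat) auto
  moreover have "k + 1 = s + r" using k assms by simp
  then have "even k \<longleftrightarrow> even s \<noteq> even r" by presburger
  ultimately show ?thesis
    unfolding s_def[symmetric] even_mult_iff even_add by auto
qed

theorem theorem1p3:
  fixes n k :: nat
  assumes "n \<ge> 1" and "k \<ge> 1"
  shows "(\<forall>m j. n = m * k + j \<and> 1 \<le> j \<and> j \<le> k - 1 \<longrightarrow>
            SgnMPE k n = SgnMPEr k n 1 \<and> SgnMPEr k n 1 = (1 - tvar) ^ (n - k)) \<and>
         (\<forall>m r. n = m * k \<and> 1 \<le> r \<and> r \<le> k \<longrightarrow>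
            SgnMPEr k n r =
              (if r = 1 then (1 - tvar) ^ (n - k)
               else (-1) ^ ((m * r - 1) * (k - r + 1)) * tvar ^ (k - r + 1) * (1 - tvar) ^ (n - k)))"
proof -
  have unshifted: "SgnMPEr k n 1 = (1 - tvar) ^ (n - k)"
    using SgnMPEr_eq[of n 0 k 1] assms by simp
  have shifted: "SgnMPEr k n r
      = (-1) ^ ((m * r - 1) * (k - r + 1)) * tvar ^ (k - r + 1) * (1 - tvar) ^ (n - k)"
    if "n = m * k" "2 \<le> r" "r \<le> k" for m r
  proof -
    have "SgnMPEr k n r
        = (-1) ^ ((k - r + 1) * (n - (k - r + 1))) * tvar ^ (k - r + 1) * (1 - tvar) ^ (n - k)"
      using that assms by (intro SgnMPEr_eq) auto
    moreover have "m \<ge> 1" using that assms by (cases m) auto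
    then have "(-1 :: int poly) ^ ((k - r + 1) * (n - (k - r + 1)))
        = (-1) ^ ((m * r - 1) * (k - r + 1))"
      using even_rotation_exponent_iff[of m r k] that by (simp only: minus_one_power_iff)
    ultimately show ?thesis by simp
  qed
  have "SgnMPE k n = SgnMPEr k n 1"
    by (simp add: SgnMPE_def SgnMPEr_def MP_eq_MPr)
  then show ?thesis
    using unshifted shifted by auto
qed

end
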